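(* Let $\varphi$ and $\psi$ be bounded analytic functions on the open unit disc $\mathbb{U}$. If $\psi$ is a nonconstant inner function and $T_\varphi\propto T_\psi$, then $\mathbb{U}\subset\sigma_p(T_\varphi^* )$.
   Context: $\mathbb{U}$ is the open unit disc in $\mathbb{C}$ and $H^2$ is the Hardy space of $\mathbb{U}$. For a bounded analytic function $\varphi$ on $\mathbb{U}$, $T_\varphi:H^2\to H^2$ is the analytic Toeplitz operator $T_\varphi h=\varphi h$. For bounded linear operators $A,B$ on a Hilbert space $\mathcal{H}$, $A\propto B$ means that there is a nonzero bounded linear operator $X$ on $\mathcal{H}$ with $XA=BX$. $\sigma_p(T)$ denotes the point spectrum (set of eigenvalues) of $T$. *)

theory Defs
  imports "HOL-Complex_Analysis.Complex_Analysis"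
begin

definition taylor_coeff :: "(complex \<Rightarrow> complex) \<Rightarrow> nat \<Rightarrow> complex" where
  "taylor_coeff f n = (deriv ^^ n) f 0 / fact n"

(* Elements of the Hardy space are functions on the open unit disc, represented by total
   functions that vanish off the disc; equality in the space is then equality of functions. *)
definition hardy2 :: "(complex \<Rightarrow> complex) set" where
  "hardy2 = {f. f holomorphic_on ball 0 1 \<and> (\<forall>z. z \<notin> ball 0 1 \<longrightarrow> f z = 0) \<and>
                summable (\<lambda>n. (cmod (taylor_coeff f n))\<^sup>2)}"

definition hardy_inner :: "(complex \<Rightarrow> complex) \<Rightarrow> (complex \<Rightarrow> complex) \<Rightarrow> complex" where
  "hardy_inner f g = (\<Sum>n. taylor_coeff f n * cnj (taylor_coeff g n))"

definition hardy_norm :: "(complex \<Rightarrow> complex) \<Rightarrow> real" where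
  "hardy_norm f = sqrt (\<Sum>n. (cmod (taylor_coeff f n))\<^sup>2)"

(* Operators are total functions of which only the values on hardy2 matter. *)
type_synonym hardy_op = "(complex \<Rightarrow> complex) \<Rightarrow> (complex \<Rightarrow> complex)"

definition bounded_hardy_op :: "hardy_op \<Rightarrow> bool" where
  "bounded_hardy_op T \<longleftrightarrow>
     (\<forall>f\<in>hardy2. T f \<in> hardy2) \<and>
     (\<forall>f\<in>hardy2. \<forall>g\<in>hardy2. T (\<lambda>z. f z + g z) = (\<lambda>z. T f z + T g z)) \<and>
     (\<forall>c. \<forall>f\<in>hardy2. T (\<lambda>z. c * f z) = (\<lambda>z. c * T f z)) \<and>
     (\<exists>K. \<forall>f\<in>hardy2. hardy_norm (T f) \<le> K * hardy_norm f)"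

definition hardy_adjoint :: "hardy_op \<Rightarrow> hardy_op" where
  "hardy_adjoint T g = (THE h. h \<in> hardy2 \<and> (\<forall>f\<in>hardy2. hardy_inner (T f) g = hardy_inner f h))"

definition point_spectrum :: "hardy_op \<Rightarrow> complex set" where
  "point_spectrum T = {c. \<exists>f\<in>hardy2. f \<noteq> (\<lambda>z. 0) \<and> T f = (\<lambda>z. c * f z)}"

definition intertwined :: "hardy_op \<Rightarrow> hardy_op \<Rightarrow> bool" (infix "\<propto>" 50) where
  "A \<propto> B \<longleftrightarrow>
     (\<exists>X. bounded_hardy_op X \<and> (\<exists>f\<in>hardy2. X f \<noteq> (\<lambda>z. 0)) \<and>
          (\<forall>f\<in>hardy2. X (A f) = B (X f)))"

definition bounded_analytic :: "(complex \<Rightarrow> complex) \<Rightarrow> bool" where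
  "bounded_analytic \<phi> \<longleftrightarrow> \<phi> holomorphic_on ball 0 1 \<and> bounded (\<phi> ` ball 0 1)"

definition toeplitz :: "(complex \<Rightarrow> complex) \<Rightarrow> hardy_op" where
  "toeplitz \<phi> h = (\<lambda>z. \<phi> z * h z)"

definition inner_function :: "(complex \<Rightarrow> complex) \<Rightarrow> bool" where
  "inner_function \<psi> \<longleftrightarrow> bounded_analytic \<psi> \<and>
     (AE t in lebesgue_on {0..2 * pi}.
        \<exists>w. cmod w = 1 \<and> ((\<lambda>r. \<psi> (of_real r * cis t)) \<longlongrightarrow> w) (at_left 1))"

end

theory Submission imports Defs begin

text \<open>Suppose \<open>X\<close> is nonzero with \<open>X T\<^sub>\<phi> = T\<^sub>\<psi> X\<close>, and suppose some \<open>c\<close> in the disc is not an eigenvalue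
  of \<open>T\<^sub>\<phi>\<^sup>*\<close>. Put \<open>\<mu> = cnj c\<close>. Then \<open>T\<^sub>\<phi>\<^sup>* - c\<close> and all its powers are injective, which says that
  the range of \<open>(T\<^sub>\<phi> - \<mu>)\<^sup>n\<close> has trivial orthogonal complement for every \<open>n\<close>.

  Since \<open>\<psi>\<close> is inner and nonconstant, \<open>|\<psi>| < 1\<close> on the disc, and the Frostman shift
  \<open>\<theta> = (\<psi> - \<mu>) / (1 - cnj \<mu> \<psi>)\<close> is again inner with \<open>|\<theta>| < 1\<close> there. The intertwining relation
  gives \<open>X (\<phi> - \<mu>)\<^sup>n f = (\<psi> - \<mu>)\<^sup>n X f = \<theta>\<^sup>n (1 - cnj \<mu> \<psi>)\<^sup>n X f\<close>, so \<open>X\<close> sends the range of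
  \<open>(T\<^sub>\<phi> - \<mu>)\<^sup>n\<close> into \<open>\<theta>\<^sup>n H\<^sup>2\<close>. As \<open>\<theta>\<^sup>n\<close> is inner, multiplication by it is an isometry and
  \<open>\<theta>\<^sup>n H\<^sup>2\<close> is closed; hence \<open>X\<close> sends all of \<open>H\<^sup>2\<close> into \<open>\<theta>\<^sup>n H\<^sup>2\<close>
  (\<open>range_divisible_by_inner\<close>). Thus \<open>X f = \<theta>\<^sup>n g\<^sub>n\<close> with \<open>\<parallel>g\<^sub>n\<parallel> = \<parallel>X f\<parallel>\<close>, and because evaluation at a
  point is bounded on \<open>H\<^sup>2\<close>, \<open>|X f (z)| \<le> |\<theta> (z)|\<^sup>n C \<parallel>X f\<parallel>\<close>. Letting \<open>n\<close> tend to infinity yields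
  \<open>X f = 0\<close>, a contradiction.

  Two analytic facts carry this. The Riesz representation theorem, read off from Taylor coefficients,
  provides the adjoints (\<open>hardy2_Riesz_representation\<close>). Parseval's identity on the circles
  \<open>|z| = r < 1\<close> bounds multiplication operators by the supremum of the symbol and, letting \<open>r\<close> tend
  to \<open>1\<close>, turns the boundary condition on an inner function into the isometry property
  (\<open>inner_function_isometry\<close>).\<close>

section \<open>The Hardy space as a space of square-summable power series\<close>

lemma taylor_coeff_eqI:
  assumes "\<And>z. z \<in> ball 0 1 \<Longrightarrow> (\<lambda>n. a n * z ^ n) sums f z"
  shows "taylor_coeff f n = a n"
proof -
  have "eventually (\<lambda>z. z \<in> ball (0::complex) 1) (nhds 0)"
    by (intro eventually_nhds_in_open) auto
  then have "eventually (\<lambda>z. (\<lambda>n. fps_nth (Abs_fps a) n * z ^ n) sums f z) (nhds 0)"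
    by eventually_elim (use assms in simp)
  then have "f has_fps_expansion Abs_fps a"
    by (rule has_fps_expansionI)
  from fps_nth_fps_expansion [OF this] show ?thesis
    by (simp add: taylor_coeff_def)
qed

lemma taylor_coeff_sums:
  assumes "f holomorphic_on ball 0 1" "z \<in> ball 0 1"
  shows "(\<lambda>n. taylor_coeff f n * z ^ n) sums f z"
  using holomorphic_power_series [OF assms] by (simp add: taylor_coeff_def)

lemma hardy2_sums: "\<lbrakk>f \<in> hardy2; z \<in> ball 0 1\<rbrakk> \<Longrightarrow> (\<lambda>n. taylor_coeff f n * z ^ n) sums f z"
  by (rule taylor_coeff_sums) (auto simp: hardy2_def)

lemma hardy2_summable: "f \<in> hardy2 \<Longrightarrow> summable (\<lambda>n. (cmod (taylor_coeff f n))\<^sup>2)"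
  by (simp add: hardy2_def)

lemma hardy2_outside: "\<lbrakk>f \<in> hardy2; z \<notin> ball 0 1\<rbrakk> \<Longrightarrow> f z = 0"
  by (simp add: hardy2_def)

lemma hardy2_holomorphic: "f \<in> hardy2 \<Longrightarrow> f holomorphic_on ball 0 1"
  by (simp add: hardy2_def)

lemma hardy2_eqI:
  assumes "f \<in> hardy2" "g \<in> hardy2" "\<And>n. taylor_coeff f n = taylor_coeff g n"
  shows "f = g"
proof
  fix z
  show "f z = g z"
  proof (cases "z \<in> ball 0 1")
    case True
    show ?thesis
      using sums_unique2 [OF hardy2_sums [OF assms(1) True]] hardy2_sums [OF assms(2) True] assms(3)
      by simp
  qed (use assms hardy2_outside in metis)
qed

text \<open>The inverse of taking Taylor coefficients: it identifies square-summable sequences with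
  elements of \<open>H\<^sup>2\<close>.\<close>

definition power_series_fun :: "(nat \<Rightarrow> complex) \<Rightarrow> complex \<Rightarrow> complex" where
  "power_series_fun a z = (if z \<in> ball 0 1 then \<Sum>n. a n * z ^ n else 0)"

lemma power_series_fun_sums:
  assumes a: "summable (\<lambda>n. (cmod (a n))\<^sup>2)" and z: "z \<in> ball 0 1"
  shows "(\<lambda>n. a n * z ^ n) sums power_series_fun a z"
proof -
  have z1: "cmod z < 1" using z by simp
  have "summable (\<lambda>n. (cmod (a n))\<^sup>2 + cmod z ^ n)"
    using a z1 by (intro summable_add summable_geometric) auto
  (* If |a n| <= 1 the geometric term dominates; otherwise |a n| <= |a n|^2. *)
  moreover have "norm (a n * z ^ n) \<le> (cmod (a n))\<^sup>2 + cmod z ^ n" for n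
  proof (cases "cmod (a n) \<le> 1")
    case True
    have "cmod (a n) * cmod z ^ n \<le> 1 * cmod z ^ n"
      using True by (intro mult_right_mono) auto
    then show ?thesis by (simp add: norm_mult norm_power add_increasing)
  next
    case False
    have "cmod (a n) * cmod z ^ n \<le> cmod (a n) * 1"
      using z1 by (intro mult_left_mono power_le_one) auto
    also have "\<dots> \<le> (cmod (a n))\<^sup>2"
      unfolding power2_eq_square using False by (intro mult_left_mono) auto
    finally show ?thesis by (simp add: norm_mult norm_power add_increasing2)
  qed
  ultimately have "summable (\<lambda>n. a n * z ^ n)"
    by (rule summable_comparison_test' [where N = 0])
  then show ?thesis
    using z by (simp add: power_series_fun_def summable_sums)
qed

lemma taylor_coeff_power_series_fun [simp]:
  "summable (\<lambda>n. (cmod (a n))\<^sup>2) \<Longrightarrow> taylor_coeff (power_series_fun a) n = a n"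
  by (rule taylor_coeff_eqI) (rule power_series_fun_sums)

lemma power_series_fun_in_hardy2:
  assumes "summable (\<lambda>n. (cmod (a n))\<^sup>2)"
  shows "power_series_fun a \<in> hardy2"
proof -
  have "power_series_fun a holomorphic_on ball 0 1"
    by (rule power_series_holomorphic [where a = a]) (use power_series_fun_sums [OF assms] in simp)
  then show ?thesis
    using assms by (simp add: hardy2_def) (simp add: power_series_fun_def)
qed

text \<open>The membership criterion behind closure under linear operations: a square-summable expansion
  valid on the disc already gives holomorphy and determines the Taylor coefficients.\<close>

lemma hardy2I:
  assumes "\<And>z. z \<in> ball 0 1 \<Longrightarrow> (\<lambda>n. a n * z ^ n) sums f z"
    and "\<And>z. z \<notin> ball 0 1 \<Longrightarrow> f z = 0"
    and a: "summable (\<lambda>n. (cmod (a n))\<^sup>2)"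
  shows "f \<in> hardy2"
proof -
  have "f = power_series_fun a"
  proof
    fix z show "f z = power_series_fun a z"
      using assms(1,2) [of z] sums_unique2 power_series_fun_sums [OF a, of z]
      by (cases "z \<in> ball 0 1") (auto simp: power_series_fun_def)
  qed
  then show ?thesis using power_series_fun_in_hardy2 [OF a] by simp
qed

lemma summable_square_add:
  fixes a b :: "nat \<Rightarrow> complex"
  assumes "summable (\<lambda>n. (cmod (a n))\<^sup>2)" "summable (\<lambda>n. (cmod (b n))\<^sup>2)"
  shows "summable (\<lambda>n. (cmod (a n + b n))\<^sup>2)"
proof (rule summable_comparison_test' [where N = 0])
  show "summable (\<lambda>n. 2 * (cmod (a n))\<^sup>2 + 2 * (cmod (b n))\<^sup>2)"
    using assms by (intro summable_add summable_mult)
  fix n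
  have "(cmod (a n + b n))\<^sup>2 \<le> (cmod (a n) + cmod (b n))\<^sup>2"
    by (intro power_mono norm_triangle_ineq) auto
  also have "\<dots> \<le> 2 * (cmod (a n))\<^sup>2 + 2 * (cmod (b n))\<^sup>2"
    using sum_squares_bound [of "cmod (a n)" "cmod (b n)"] by (simp add: power2_sum)
  finally show "norm ((cmod (a n + b n))\<^sup>2) \<le> 2 * (cmod (a n))\<^sup>2 + 2 * (cmod (b n))\<^sup>2"
    by simp
qed

lemma
  assumes "f \<in> hardy2" "g \<in> hardy2"
  shows taylor_coeff_add: "taylor_coeff (\<lambda>z. f z + g z) n = taylor_coeff f n + taylor_coeff g n"
    and hardy2_add: "(\<lambda>z. f z + g z) \<in> hardy2"
proof -
  have s: "(\<lambda>n. (taylor_coeff f n + taylor_coeff g n) * z ^ n) sums (f z + g z)"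
    if "z \<in> ball 0 1" for z
    using sums_add [OF hardy2_sums [OF assms(1) that] hardy2_sums [OF assms(2) that]]
    by (simp add: algebra_simps)
  show "taylor_coeff (\<lambda>z. f z + g z) n = taylor_coeff f n + taylor_coeff g n"
    by (rule taylor_coeff_eqI) (rule s)
  show "(\<lambda>z. f z + g z) \<in> hardy2"
    by (rule hardy2I [OF s])
       (use assms in \<open>auto intro!: summable_square_add simp: hardy2_summable hardy2_outside\<close>)
qed

lemma
  assumes "f \<in> hardy2"
  shows taylor_coeff_cmult: "taylor_coeff (\<lambda>z. c * f z) n = c * taylor_coeff f n"
    and hardy2_cmult: "(\<lambda>z. c * f z) \<in> hardy2"
proof -
  have s: "(\<lambda>n. (c * taylor_coeff f n) * z ^ n) sums (c * f z)" if "z \<in> ball 0 1" for z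
    using sums_mult [OF hardy2_sums [OF assms(1) that], of c] by (simp add: algebra_simps)
  show "taylor_coeff (\<lambda>z. c * f z) n = c * taylor_coeff f n"
    by (rule taylor_coeff_eqI) (rule s)
  show "(\<lambda>z. c * f z) \<in> hardy2"
    by (rule hardy2I [OF s])
       (use assms in
         \<open>auto simp: norm_mult power_mult_distrib hardy2_outside intro!: summable_mult hardy2_summable\<close>)
qed

lemma
  assumes "f \<in> hardy2" "g \<in> hardy2"
  shows taylor_coeff_diff: "taylor_coeff (\<lambda>z. f z - g z) n = taylor_coeff f n - taylor_coeff g n"
    and hardy2_diff: "(\<lambda>z. f z - g z) \<in> hardy2"
  using taylor_coeff_add [OF assms(1) hardy2_cmult [OF assms(2), of "-1"]]
    hardy2_add [OF assms(1) hardy2_cmult [OF assms(2), of "-1"]]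
    taylor_coeff_cmult [OF assms(2), of "-1"]
  by simp_all

lemma
  shows zero_in_hardy2: "(\<lambda>z. 0) \<in> hardy2"
    and taylor_coeff_zero: "taylor_coeff (\<lambda>z. 0) n = 0"
  by (rule hardy2I [where a = "\<lambda>n. 0"], auto intro: taylor_coeff_eqI)

section \<open>Norm and inner product\<close>

lemma hardy_norm_nonneg: "f \<in> hardy2 \<Longrightarrow> 0 \<le> hardy_norm f"
  unfolding hardy_norm_def by (simp add: hardy2_summable suminf_nonneg)

lemma hardy_norm_power2: "f \<in> hardy2 \<Longrightarrow> (hardy_norm f)\<^sup>2 = (\<Sum>n. (cmod (taylor_coeff f n))\<^sup>2)"
  unfolding hardy_norm_def by (simp add: hardy2_summable suminf_nonneg)

lemma L2_set_le_hardy_norm: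
  "f \<in> hardy2 \<Longrightarrow> L2_set (\<lambda>n. cmod (taylor_coeff f n)) {..<N} \<le> hardy_norm f"
  unfolding L2_set_def hardy_norm_def
  by (intro real_sqrt_le_mono sum_le_suminf hardy2_summable) auto

lemma hardy_norm_leI:
  assumes "f \<in> hardy2" "0 \<le> B" "\<And>N. (\<Sum>n<N. (cmod (taylor_coeff f n))\<^sup>2) \<le> B\<^sup>2"
  shows "hardy_norm f \<le> B"
  unfolding hardy_norm_def
  by (rule real_le_lsqrt) (use assms hardy2_summable in \<open>auto intro!: suminf_le_const suminf_nonneg\<close>)

lemma hardy_norm_triangle:
  assumes f: "f \<in> hardy2" and g: "g \<in> hardy2"
  shows "hardy_norm (\<lambda>z. f z + g z) \<le> hardy_norm f + hardy_norm g"
proof (rule hardy_norm_leI)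
  fix N
  let ?a = "\<lambda>n. cmod (taylor_coeff f n)" and ?b = "\<lambda>n. cmod (taylor_coeff g n)"
  have "L2_set (\<lambda>n. cmod (taylor_coeff f n + taylor_coeff g n)) {..<N} \<le> L2_set (\<lambda>n. ?a n + ?b n) {..<N}"
    by (intro L2_set_mono norm_triangle_ineq) auto
  also have "\<dots> \<le> L2_set ?a {..<N} + L2_set ?b {..<N}"
    by (rule L2_set_triangle_ineq)
  also have "\<dots> \<le> hardy_norm f + hardy_norm g"
    using f g by (intro add_mono L2_set_le_hardy_norm)
  finally show "(\<Sum>n<N. (cmod (taylor_coeff (\<lambda>z. f z + g z) n))\<^sup>2) \<le> (hardy_norm f + hardy_norm g)\<^sup>2"
    unfolding L2_set_def taylor_coeff_add [OF f g] by (rule sqrt_le_D)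
qed (use assms in \<open>auto simp: hardy2_add hardy_norm_nonneg\<close>)

lemma hardy_norm_cmult:
  assumes "f \<in> hardy2"
  shows "hardy_norm (\<lambda>z. c * f z) = cmod c * hardy_norm f"
  using hardy2_summable [OF assms]
  by (simp add: hardy_norm_def taylor_coeff_cmult [OF assms] norm_mult power_mult_distrib
      suminf_mult real_sqrt_mult)

lemma hardy_inner_summable:
  assumes f: "f \<in> hardy2" and g: "g \<in> hardy2"
  shows "summable (\<lambda>n. cmod (taylor_coeff f n * cnj (taylor_coeff g n)))"
    and "(\<Sum>n. cmod (taylor_coeff f n * cnj (taylor_coeff g n))) \<le> hardy_norm f * hardy_norm g"
proof -
  have *: "(\<Sum>n<N. cmod (taylor_coeff f n * cnj (taylor_coeff g n))) \<le> hardy_norm f * hardy_norm g" for N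
  proof -
    have "(\<Sum>n<N. cmod (taylor_coeff f n * cnj (taylor_coeff g n)))
        \<le> L2_set (\<lambda>n. cmod (taylor_coeff f n)) {..<N} * L2_set (\<lambda>n. cmod (taylor_coeff g n)) {..<N}"
      using L2_set_mult_ineq [of "\<lambda>n. cmod (taylor_coeff f n)" "\<lambda>n. cmod (taylor_coeff g n)" "{..<N}"]
      by (simp add: norm_mult)
    also have "\<dots> \<le> hardy_norm f * hardy_norm g"
      using f g by (intro mult_mono L2_set_le_hardy_norm hardy_norm_nonneg L2_set_nonneg) 
    finally show ?thesis .
  qed
  show "summable (\<lambda>n. cmod (taylor_coeff f n * cnj (taylor_coeff g n)))"
    by (rule summableI_nonneg_bounded [OF _ *]) auto
  then show "(\<Sum>n. cmod (taylor_coeff f n * cnj (taylor_coeff g n))) \<le> hardy_norm f * hardy_norm g"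
    by (rule suminf_le_const [OF _ *])
qed

lemma hardy_inner_sums:
  assumes "f \<in> hardy2" "g \<in> hardy2"
  shows "(\<lambda>n. taylor_coeff f n * cnj (taylor_coeff g n)) sums hardy_inner f g"
  unfolding hardy_inner_def
  by (rule summable_sums [OF summable_norm_cancel [OF hardy_inner_summable(1) [OF assms]]])

lemma hardy_Cauchy_Schwarz:
  assumes "f \<in> hardy2" "g \<in> hardy2"
  shows "cmod (hardy_inner f g) \<le> hardy_norm f * hardy_norm g"
  unfolding hardy_inner_def
  using summable_norm [OF hardy_inner_summable(1) [OF assms]] hardy_inner_summable(2) [OF assms]
  by linarith

lemma hardy_inner_self:
  assumes "f \<in> hardy2"
  shows "hardy_inner f f = of_real ((hardy_norm f)\<^sup>2)"
proof -
  have "(\<lambda>n. complex_of_real ((cmod (taylor_coeff f n))\<^sup>2)) sums of_real ((hardy_norm f)\<^sup>2)"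
    unfolding sums_of_real_iff hardy_norm_power2 [OF assms]
    by (rule summable_sums [OF hardy2_summable [OF assms]])
  then have "(\<lambda>n. taylor_coeff f n * cnj (taylor_coeff f n)) sums of_real ((hardy_norm f)\<^sup>2)"
    unfolding complex_norm_square .
  then show ?thesis
    by (rule sums_unique2 [OF hardy_inner_sums [OF assms assms]])
qed

lemma hardy_inner_add_left:
  assumes "f \<in> hardy2" "g \<in> hardy2" "h \<in> hardy2"
  shows "hardy_inner (\<lambda>z. f z + g z) h = hardy_inner f h + hardy_inner g h"
  by (rule sums_unique2 [OF hardy_inner_sums [OF hardy2_add [OF assms(1,2)] assms(3)]])
     (use sums_add [OF hardy_inner_sums [OF assms(1,3)] hardy_inner_sums [OF assms(2,3)]]
       in \<open>simp add: taylor_coeff_add [OF assms(1,2)] algebra_simps\<close>)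

lemma hardy_inner_cmult_left:
  assumes "f \<in> hardy2" "h \<in> hardy2"
  shows "hardy_inner (\<lambda>z. c * f z) h = c * hardy_inner f h"
  by (rule sums_unique2 [OF hardy_inner_sums [OF hardy2_cmult [OF assms(1)] assms(2)]])
     (use sums_mult [OF hardy_inner_sums [OF assms], of c]
       in \<open>simp add: taylor_coeff_cmult [OF assms(1)] algebra_simps\<close>)

lemma hardy_inner_commute:
  assumes "f \<in> hardy2" "g \<in> hardy2"
  shows "hardy_inner g f = cnj (hardy_inner f g)"
proof -
  have "(\<lambda>n. cnj (taylor_coeff f n * cnj (taylor_coeff g n))) sums cnj (hardy_inner f g)"
    using hardy_inner_sums [OF assms] by (simp only: sums_cnj)
  then show ?thesis
    by (intro sums_unique2 [OF hardy_inner_sums [OF assms(2,1)]]) (simp add: mult.commute)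
qed

lemma hardy_inner_diff_left:
  assumes "f \<in> hardy2" "g \<in> hardy2" "h \<in> hardy2"
  shows "hardy_inner (\<lambda>z. f z - g z) h = hardy_inner f h - hardy_inner g h"
  using hardy_inner_add_left [OF assms(1) hardy2_cmult [OF assms(2), of "-1"] assms(3)]
    hardy_inner_cmult_left [OF assms(2,3), of "-1"]
  by simp

lemma hardy_inner_diff_right:
  assumes "f \<in> hardy2" "g \<in> hardy2" "h \<in> hardy2"
  shows "hardy_inner h (\<lambda>z. f z - g z) = hardy_inner h f - hardy_inner h g"
  using hardy_inner_diff_left [OF assms] assms hardy2_diff [OF assms(1,2)]
  by (simp add: hardy_inner_commute [of _ h])

lemma hardy_inner_cmult_right:
  assumes "f \<in> hardy2" "h \<in> hardy2"
  shows "hardy_inner h (\<lambda>z. c * f z) = cnj c * hardy_inner h f"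
  using hardy_inner_cmult_left [OF assms] assms hardy2_cmult [OF assms(1), of c]
  by (simp add: hardy_inner_commute [of _ h])

lemma hardy_inner_self_eq_0:
  assumes "f \<in> hardy2" "hardy_inner f f = 0"
  shows "f = (\<lambda>z. 0)"
proof (rule hardy2_eqI [OF assms(1) zero_in_hardy2])
  have "(\<Sum>n. (cmod (taylor_coeff f n))\<^sup>2) = 0"
    using assms hardy_inner_self hardy_norm_power2 by force
  then have "(cmod (taylor_coeff f n))\<^sup>2 = 0" for n
    using suminf_eq_zero_iff [OF hardy2_summable [OF assms(1)]] by auto
  then show "taylor_coeff f n = taylor_coeff (\<lambda>z. 0) n" for n
    by (simp add: taylor_coeff_zero)
qed

lemma hardy_inner_ext:
  assumes "g \<in> hardy2" "h \<in> hardy2" "\<And>f. f \<in> hardy2 \<Longrightarrow> hardy_inner f g = hardy_inner f h"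
  shows "g = h"
proof -
  let ?d = "\<lambda>z. g z - h z"
  have "hardy_inner ?d ?d = 0"
    using assms by (simp add: hardy_inner_diff_right hardy2_diff)
  then have "?d = (\<lambda>z. 0)"
    using hardy_inner_self_eq_0 [OF hardy2_diff] assms by blast
  then show ?thesis by (simp add: fun_eq_iff)
qed

text \<open>Evaluation at \<open>w\<close> is the inner product with the Szego kernel \<open>1 / (1 - cnj w * z)\<close>, whose
  Taylor coefficients are the powers of \<open>cnj w\<close>; the bound is the Cauchy-Schwarz inequality.\<close>

lemma hardy2_point_evaluation_bounded:
  assumes w: "w \<in> ball 0 1"
  obtains C where "\<And>f. f \<in> hardy2 \<Longrightarrow> cmod (f w) \<le> C * hardy_norm f"
proof
  let ?k = "power_series_fun (\<lambda>n. cnj w ^ n)"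
  have "(cmod w)\<^sup>2 < 1"
    using w by (simp add: power_less_one_iff)
  then have "summable (\<lambda>n. ((cmod w)\<^sup>2) ^ n)"
    by (intro summable_geometric) auto
  then have s: "summable (\<lambda>n. (cmod (cnj w ^ n))\<^sup>2)"
    by (simp add: norm_power power_mult [symmetric] mult.commute)
  fix f assume f: "f \<in> hardy2"
  have "hardy_inner f ?k = f w"
    by (rule sums_unique2 [OF hardy_inner_sums [OF f power_series_fun_in_hardy2 [OF s]]])
       (use hardy2_sums [OF f w] s in simp)
  then show "cmod (f w) \<le> hardy_norm ?k * hardy_norm f"
    using hardy_Cauchy_Schwarz [OF f power_series_fun_in_hardy2 [OF s]] by (simp add: mult.commute)
qed

section \<open>Polynomial approximation, the Riesz representation, and adjoints\<close>

definition disc_monomial :: "nat \<Rightarrow> complex \<Rightarrow> complex" where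
  "disc_monomial n z = (if z \<in> ball 0 1 then z ^ n else 0)"

lemma
  shows taylor_coeff_disc_monomial: "taylor_coeff (disc_monomial n) k = (if k = n then 1 else 0)"
    and disc_monomial_in_hardy2: "disc_monomial n \<in> hardy2"
proof -
  have s: "(\<lambda>k. (if k = n then 1 else 0) * z ^ k) sums disc_monomial n z" if "z \<in> ball 0 1" for z
    using sums_If_finite_set [of "{n}" "\<lambda>k. z ^ k"] that
    by (simp add: disc_monomial_def if_distrib [of "\<lambda>x. x * _"] cong: if_cong)
  show "taylor_coeff (disc_monomial n) k = (if k = n then 1 else 0)"
    by (rule taylor_coeff_eqI) (rule s)
  show "disc_monomial n \<in> hardy2"
    by (rule hardy2I [OF s]) (auto simp: disc_monomial_def intro!: summable_finite [of "{n}"] split: if_splits)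
qed

definition disc_polynomial :: "(nat \<Rightarrow> complex) \<Rightarrow> nat \<Rightarrow> complex \<Rightarrow> complex" where
  "disc_polynomial a N z = (\<Sum>n<N. a n * disc_monomial n z)"

lemma disc_polynomial_Suc:
  "disc_polynomial a (Suc N) = (\<lambda>z. disc_polynomial a N z + a N * disc_monomial N z)"
  by (simp add: disc_polynomial_def fun_eq_iff)

lemma disc_polynomial_in_hardy2: "disc_polynomial a N \<in> hardy2"
proof (induction N)
  case 0
  then show ?case by (simp add: disc_polynomial_def [abs_def] zero_in_hardy2)
next
  case (Suc N)
  then show ?case
    by (simp add: disc_polynomial_Suc hardy2_add hardy2_cmult disc_monomial_in_hardy2)
qed

lemma taylor_coeff_disc_polynomial:
  "taylor_coeff (disc_polynomial a N) k = (if k < N then a k else 0)"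
proof (induction N)
  case 0
  then show ?case by (simp add: disc_polynomial_def [abs_def] taylor_coeff_zero)
next
  case (Suc N)
  then show ?case
    by (auto simp: disc_polynomial_Suc taylor_coeff_add taylor_coeff_cmult hardy2_cmult
        disc_polynomial_in_hardy2 disc_monomial_in_hardy2 taylor_coeff_disc_monomial less_Suc_eq)
qed

lemma hardy_norm_disc_polynomial:
  "hardy_norm (disc_polynomial a N) = sqrt (\<Sum>n<N. (cmod (a n))\<^sup>2)"
proof -
  have "(\<lambda>k. if k \<in> {..<N} then (cmod (a k))\<^sup>2 else 0) sums (\<Sum>n<N. (cmod (a n))\<^sup>2)"
    by (rule sums_If_finite_set) simp
  moreover have "(\<lambda>k. if k \<in> {..<N} then (cmod (a k))\<^sup>2 else 0)
      = (\<lambda>k. (cmod (taylor_coeff (disc_polynomial a N) k))\<^sup>2)"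
    by (auto simp: taylor_coeff_disc_polynomial)
  ultimately show ?thesis
    by (simp add: hardy_norm_def sums_iff)
qed

lemma disc_polynomial_approximates:
  assumes f: "f \<in> hardy2"
  shows "(\<lambda>N. hardy_norm (\<lambda>z. f z - disc_polynomial (taylor_coeff f) N z)) \<longlonglongrightarrow> 0"
proof -
  let ?a = "\<lambda>n. (cmod (taylor_coeff f n))\<^sup>2"
  have "hardy_norm (\<lambda>z. f z - disc_polynomial (taylor_coeff f) N z)
      = sqrt (suminf ?a - (\<Sum>n<N. ?a n))" for N
  proof -
    have "(\<lambda>k. if k \<in> {..<N} then ?a k else 0) sums (\<Sum>n<N. ?a n)"
      by (rule sums_If_finite_set) simp
    with summable_sums [OF hardy2_summable [OF f]]
    have "(\<lambda>k. ?a k - (if k \<in> {..<N} then ?a k else 0)) sums (suminf ?a - (\<Sum>n<N. ?a n))"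
      by (rule sums_diff)
    moreover have "(\<lambda>k. ?a k - (if k \<in> {..<N} then ?a k else 0))
      = (\<lambda>k. (cmod (taylor_coeff (\<lambda>z. f z - disc_polynomial (taylor_coeff f) N z) k))\<^sup>2)"
      by (auto simp: taylor_coeff_diff [OF f disc_polynomial_in_hardy2] taylor_coeff_disc_polynomial)
    ultimately show ?thesis
      by (simp add: hardy_norm_def sums_iff)
  qed
  moreover have "(\<lambda>N. sqrt (suminf ?a - (\<Sum>n<N. ?a n))) \<longlonglongrightarrow> sqrt (suminf ?a - suminf ?a)"
    by (intro tendsto_intros summable_LIMSEQ hardy2_summable f)
  ultimately show ?thesis by simp
qed

text \<open>The representing element can be written down: its coefficients are the conjugated values
  of the functional on the monomials. Testing the functional on the polynomial with these
  coefficients shows that they are square-summable.\<close>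

lemma hardy2_Riesz_representation:
  assumes add: "\<And>f g. \<lbrakk>f \<in> hardy2; g \<in> hardy2\<rbrakk> \<Longrightarrow> L (\<lambda>z. f z + g z) = L f + L g"
    and cmult: "\<And>c f. f \<in> hardy2 \<Longrightarrow> L (\<lambda>z. c * f z) = c * L f"
    and bound: "\<And>f. f \<in> hardy2 \<Longrightarrow> cmod (L f) \<le> K * hardy_norm f"
  obtains h where "h \<in> hardy2" "\<And>f. f \<in> hardy2 \<Longrightarrow> L f = hardy_inner f h"
proof
  define b where "b n = cnj (L (disc_monomial n))" for n
  have L_poly: "L (disc_polynomial a N) = (\<Sum>n<N. a n * cnj (b n))" for a N
  proof (induction N)
    case 0
    have "L (\<lambda>z. 0) = 0" using cmult [OF zero_in_hardy2, of 0] by simp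
    then show ?case by (simp add: disc_polynomial_def [abs_def])
  next
    case (Suc N)
    then show ?case
      by (simp add: disc_polynomial_Suc add cmult hardy2_cmult disc_polynomial_in_hardy2
          disc_monomial_in_hardy2 b_def)
  qed
  have "(\<Sum>n<N. (cmod (b n))\<^sup>2) \<le> K\<^sup>2" for N
  proof -
    define S where "S = (\<Sum>n<N. (cmod (b n))\<^sup>2)"
    have S0: "S \<ge> 0" by (simp add: S_def sum_nonneg)
    have "L (disc_polynomial b N) = of_real S"
      unfolding L_poly S_def of_real_sum complex_norm_square by simp
    (* The polynomial with coefficients b has norm sqrt S. *)
    then have "S \<le> K * sqrt S"
      using bound [OF disc_polynomial_in_hardy2, of b N] S0
      by (simp add: hardy_norm_disc_polynomial S_def [symmetric])
    then have "sqrt S * sqrt S \<le> K * sqrt S"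
      using S0 by simp
    then have "S = 0 \<or> sqrt S \<le> K"
      using S0 by (metis mult_right_le_imp_le order_le_less real_sqrt_gt_zero)
    then show ?thesis
      unfolding S_def [symmetric] using sqrt_le_D by auto
  qed
  then have b: "summable (\<lambda>n. (cmod (b n))\<^sup>2)"
    by (intro summableI_nonneg_bounded) auto
  show h: "power_series_fun b \<in> hardy2"
    by (rule power_series_fun_in_hardy2 [OF b])
  fix f assume f: "f \<in> hardy2"
  let ?p = "disc_polynomial (taylor_coeff f)"
  have "(\<lambda>N. L (?p N)) \<longlonglongrightarrow> hardy_inner f (power_series_fun b)"
    using hardy_inner_sums [OF f h] b by (simp add: L_poly sums_def)
  moreover have "(\<lambda>N. L (?p N)) \<longlonglongrightarrow> L f"
  proof -
    have "(\<lambda>N. L (\<lambda>z. f z - ?p N z)) \<longlonglongrightarrow> 0"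
    proof (rule Lim_null_comparison)
      show "\<forall>\<^sub>F N in sequentially. norm (L (\<lambda>z. f z - ?p N z)) \<le> K * hardy_norm (\<lambda>z. f z - ?p N z)"
        by (intro always_eventually allI bound hardy2_diff f disc_polynomial_in_hardy2)
      show "(\<lambda>N. K * hardy_norm (\<lambda>z. f z - ?p N z)) \<longlonglongrightarrow> 0"
        by (intro tendsto_mult_right_zero disc_polynomial_approximates f)
    qed
    moreover have "L (\<lambda>z. f z - ?p N z) = L f - L (?p N)" for N
      using add [OF f hardy2_cmult [OF disc_polynomial_in_hardy2], of "-1"]
        cmult [OF disc_polynomial_in_hardy2, of "-1"] by simp
    ultimately have "(\<lambda>N. L f - L (?p N)) \<longlonglongrightarrow> 0" by simp
    from tendsto_diff [OF tendsto_const [of "L f"] this] show ?thesis by simp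
  qed
  ultimately show "L f = hardy_inner f (power_series_fun b)"
    using LIMSEQ_unique by blast
qed

text \<open>The description in the definition of the adjoint has at most one solution, because an element
  of \<open>H\<^sup>2\<close> is determined by its inner products. So exhibiting a solution computes the adjoint.\<close>

lemma hardy_adjoint_eqI:
  assumes "h \<in> hardy2" "\<And>f. f \<in> hardy2 \<Longrightarrow> hardy_inner (T f) g = hardy_inner f h"
  shows "hardy_adjoint T g = h"
  unfolding hardy_adjoint_def
  by (rule the_equality) (use assms in \<open>auto intro!: hardy_inner_ext\<close>)

lemma
  assumes T: "bounded_hardy_op T" and g: "g \<in> hardy2"
  shows hardy_adjoint_in_hardy2: "hardy_adjoint T g \<in> hardy2"
    and hardy_inner_adjoint: "f \<in> hardy2 \<Longrightarrow> hardy_inner (T f) g = hardy_inner f (hardy_adjoint T g)"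
proof -
  from T obtain K where K: "\<And>f. f \<in> hardy2 \<Longrightarrow> hardy_norm (T f) \<le> K * hardy_norm f"
    unfolding bounded_hardy_op_def by blast
  have T2: "f \<in> hardy2 \<Longrightarrow> T f \<in> hardy2" for f
    using T by (auto simp: bounded_hardy_op_def)
  obtain h where h: "h \<in> hardy2" "\<And>f. f \<in> hardy2 \<Longrightarrow> hardy_inner (T f) g = hardy_inner f h"
  proof (rule hardy2_Riesz_representation [where L = "\<lambda>f. hardy_inner (T f) g"])
    show "cmod (hardy_inner (T f) g) \<le> (K * hardy_norm g) * hardy_norm f" if "f \<in> hardy2" for f
    proof -
      have "cmod (hardy_inner (T f) g) \<le> hardy_norm (T f) * hardy_norm g"
        by (intro hardy_Cauchy_Schwarz T2 that g)
      also have "\<dots> \<le> (K * hardy_norm f) * hardy_norm g"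
        by (intro mult_right_mono K that hardy_norm_nonneg g)
      finally show ?thesis by (simp add: mult_ac)
    qed
  qed (use T g in \<open>auto simp: bounded_hardy_op_def hardy_inner_add_left hardy_inner_cmult_left\<close>)
  have "hardy_adjoint T g = h"
    by (rule hardy_adjoint_eqI) (use h in auto)
  with h show "hardy_adjoint T g \<in> hardy2"
    "f \<in> hardy2 \<Longrightarrow> hardy_inner (T f) g = hardy_inner f (hardy_adjoint T g)" by auto
qed


section \<open>Parseval's identity on circles\<close>

text \<open>The square of the \<open>L\<^sup>2\<close> norm on the circle of radius \<open>r\<close> for normalised arc length. The
  Lebesgue measure is the one in which boundary values of inner functions are given, so that
  dominated convergence can be applied to them.\<close>

definition circle_mean :: "(complex \<Rightarrow> complex) \<Rightarrow> real \<Rightarrow> real" where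
  "circle_mean f r = (LINT t|lebesgue_on {0..2 * pi}. (cmod (f (of_real r * cis t)))\<^sup>2) / (2 * pi)"

lemma has_integral_cis:
  "((\<lambda>t. cis (of_int k * t)) has_integral (if k = 0 then 2 * pi else 0)) {0..2 * pi}"
proof (cases "k = 0")
  case True
  then show ?thesis
    using has_integral_const_real [of "1::complex" 0 "2 * pi"] by (simp add: scaleR_conv_of_real)
next
  case False
  let ?F = "\<lambda>t. cis (of_int k * t) / (\<i> * of_int k)"
  have "((\<lambda>t. cis (of_int k * t)) has_integral (?F (2 * pi) - ?F 0)) {0..2 * pi}"
  proof (rule fundamental_theorem_of_calculus)
    fix t :: real
    have "((\<lambda>t. exp (\<i> * of_int k * of_real t) / (\<i> * of_int k)) has_vector_derivative
        exp (\<i> * of_int k * of_real t)) (at t within {0..2 * pi})"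
      using False by (auto intro!: derivative_eq_intros has_vector_derivative_real_field)
    then show "(?F has_vector_derivative cis (of_int k * t)) (at t within {0..2 * pi})"
      by (simp add: cis_conv_exp mult_ac)
  qed simp
  moreover have "cis (of_int k * (2 * pi)) = 1"
    using cis_multiple_2pi [of "of_int k"] by (simp add: mult_ac)
  ultimately show ?thesis using False by simp
qed

text \<open>Expanding \<open>|p|\<^sup>2\<close> as a double sum, only the diagonal terms survive integration by the
  orthogonality of the characters.\<close>

lemma circle_mean_polynomial:
  "circle_mean (\<lambda>z. \<Sum>n<N. a n * z ^ n) r = (\<Sum>n<N. (cmod (a n))\<^sup>2 * r ^ (2 * n))"
proof -
  define d where "d n = a n * of_real r ^ n" for n
  let ?p = "\<lambda>t. \<Sum>n<N. a n * (of_real r * cis t) ^ n"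
  let ?g = "\<lambda>t. \<Sum>n<N. \<Sum>m<N. d n * cnj (d m) * cis (of_int (int n - int m) * t)"
  have p: "?p t = (\<Sum>n<N. d n * cis (of_int (int n) * t))" for t
    unfolding d_def by (intro sum.cong refl)
      (simp only: power_mult_distrib Complex.DeMoivre of_int_of_nat_eq mult.assoc)
  have g: "complex_of_real ((cmod (?p t))\<^sup>2) = ?g t" for t
    unfolding complex_norm_square p cnj_sum sum_product
    by (intro sum.cong refl) (simp add: cis_cnj cis_mult algebra_simps)
  have "(?g has_integral (\<Sum>n<N. \<Sum>m<N. d n * cnj (d m) * (if int n - int m = 0 then 2 * pi else 0)))
      {0..2 * pi}"
    by (intro has_integral_sum has_integral_mult_right has_integral_cis) auto
  also have "(\<Sum>n<N. \<Sum>m<N. d n * cnj (d m) * (if int n - int m = 0 then 2 * pi else 0))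
      = (\<Sum>n<N. \<Sum>m<N. if m = n then d n * cnj (d n) * (2 * pi) else 0)"
    by (intro sum.cong refl) auto
  also have "\<dots> = of_real (2 * pi * (\<Sum>n<N. (cmod (d n))\<^sup>2))"
    unfolding of_real_mult of_real_sum complex_norm_square
    by (simp add: sum_distrib_left mult_ac)
  finally have "((\<lambda>t. complex_of_real ((cmod (?p t))\<^sup>2)) has_integral
      of_real (2 * pi * (\<Sum>n<N. (cmod (d n))\<^sup>2))) {0..2 * pi}"
    unfolding g .
  from has_integral_linear [OF this bounded_linear_Re]
  have "((\<lambda>t. (cmod (?p t))\<^sup>2) has_integral (2 * pi * (\<Sum>n<N. (cmod (d n))\<^sup>2))) {0..2 * pi}"
    by (simp add: o_def)
  moreover have "integral\<^sup>L (lebesgue_on {0..2 * pi}) (\<lambda>t. (cmod (?p t))\<^sup>2)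
      = integral {0..2 * pi} (\<lambda>t. (cmod (?p t))\<^sup>2)"
    by (intro lebesgue_integral_eq_integral continuous_imp_integrable_real continuous_intros) auto
  ultimately have "circle_mean (\<lambda>z. \<Sum>n<N. a n * z ^ n) r = (\<Sum>n<N. (cmod (d n))\<^sup>2)"
    by (simp add: circle_mean_def integral_unique)
  then show ?thesis
    by (simp add: d_def norm_mult norm_power power_mult_distrib power_mult [symmetric] mult.commute
        power_even_abs)
qed

lemma circle_in_disc: "\<lbrakk>0 \<le> r; r < 1\<rbrakk> \<Longrightarrow> of_real r * cis t \<in> ball 0 1"
  by (simp add: norm_mult)

lemma continuous_on_circle:
  assumes "f holomorphic_on ball 0 1" "0 \<le> r" "r < 1"
  shows "continuous_on A (\<lambda>t. f (of_real r * cis t))"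
  by (rule continuous_on_compose2 [OF holomorphic_on_imp_continuous_on [OF assms(1)]])
     (use circle_in_disc [OF assms(2,3)] in \<open>auto intro!: continuous_intros\<close>)

lemma integrable_on_circle:
  assumes "f holomorphic_on ball 0 1" "0 \<le> r" "r < 1"
  shows "integrable (lebesgue_on {0..2 * pi}) (\<lambda>t. (cmod (f (of_real r * cis t)))\<^sup>2)"
  by (intro continuous_imp_integrable_real continuous_intros continuous_on_circle assms)

text \<open>Passing from the polynomial case to the limit is dominated convergence, since the partial sums
  are bounded on the circle by the absolutely convergent series \<open>\<Sum>n. |a\<^sub>n| r\<^sup>n\<close>.\<close>

lemma circle_mean_Parseval:
  assumes f: "f holomorphic_on ball 0 1" and r: "0 \<le> r" "r < 1"
  shows "(\<lambda>n. (cmod (taylor_coeff f n))\<^sup>2 * r ^ (2 * n)) sums circle_mean f r"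
proof -
  let ?a = "taylor_coeff f"
  let ?p = "\<lambda>N z. \<Sum>n<N. ?a n * z ^ n"
  let ?M = "lebesgue_on {0..2 * pi}"
  have "summable (\<lambda>n. ?a n * of_real ((1 + r) / 2) ^ n)"
    by (rule sums_summable [OF taylor_coeff_sums [OF f]]) (use r in \<open>simp del: of_real_divide of_real_add\<close>)
  then have "summable (\<lambda>n. norm (?a n * of_real r ^ n))"
    by (rule powser_insidea) (use r in \<open>simp del: of_real_divide of_real_add\<close>)
  then have s: "summable (\<lambda>n. cmod (?a n) * r ^ n)"
    using r by (simp add: norm_mult norm_power)
  define C where "C = (\<Sum>n. cmod (?a n) * r ^ n)"
  have bound: "cmod (?p N (of_real r * cis t)) \<le> C" for N t
  proof -
    have "cmod (?p N (of_real r * cis t)) \<le> (\<Sum>n<N. cmod (?a n) * r ^ n)"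
      by (rule sum_norm_le) (use r in \<open>simp add: norm_mult norm_power\<close>)
    also have "\<dots> \<le> C"
      unfolding C_def using r by (intro sum_le_suminf s) auto
    finally show ?thesis .
  qed
  have "(\<lambda>N. integral\<^sup>L ?M (\<lambda>t. (cmod (?p N (of_real r * cis t)))\<^sup>2))
      \<longlonglongrightarrow> integral\<^sup>L ?M (\<lambda>t. (cmod (f (of_real r * cis t)))\<^sup>2)"
  proof (rule integral_dominated_convergence [where w = "\<lambda>t. C\<^sup>2"])
    show "(\<lambda>t. (cmod (f (of_real r * cis t)))\<^sup>2) \<in> borel_measurable ?M"
      by (intro borel_measurable_integrable integrable_on_circle f r)
    show "(\<lambda>t. (cmod (?p N (of_real r * cis t)))\<^sup>2) \<in> borel_measurable ?M" for N
      by (intro borel_measurable_integrable continuous_imp_integrable_real continuous_intros)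
    show "integrable ?M (\<lambda>t. C\<^sup>2)"
      by (intro continuous_imp_integrable_real continuous_intros)
    show "AE t in ?M. (\<lambda>N. (cmod (?p N (of_real r * cis t)))\<^sup>2) \<longlonglongrightarrow> (cmod (f (of_real r * cis t)))\<^sup>2"
      using taylor_coeff_sums [OF f circle_in_disc [OF r]]
      by (intro AE_I2 tendsto_intros) (simp add: sums_def)
    show "AE t in ?M. norm ((cmod (?p N (of_real r * cis t)))\<^sup>2) \<le> C\<^sup>2" for N
      using bound by (intro AE_I2) (simp add: power_mono)
  qed
  then have "(\<lambda>N. circle_mean (?p N) r) \<longlonglongrightarrow> circle_mean f r"
    unfolding circle_mean_def by (intro tendsto_intros) auto
  then show ?thesis
    by (simp add: circle_mean_polynomial sums_def)
qed

lemma circle_mean_le_hardy_norm: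
  assumes f: "f \<in> hardy2" and r: "0 \<le> r" "r < 1"
  shows "circle_mean f r \<le> (hardy_norm f)\<^sup>2"
proof -
  have "(cmod (taylor_coeff f n))\<^sup>2 * r ^ (2 * n) \<le> (cmod (taylor_coeff f n))\<^sup>2" for n
    using r by (intro mult_right_le_one_le power_le_one) auto
  then show ?thesis
    using sums_le [OF _ circle_mean_Parseval [OF hardy2_holomorphic [OF f] r]
        summable_sums [OF hardy2_summable [OF f]]]
    by (simp add: hardy_norm_power2 [OF f])
qed

text \<open>Each partial sum of \<open>\<Sum>n. |a\<^sub>n|\<^sup>2\<close> is the limit of the corresponding partial sums of
  \<open>\<Sum>n. |a\<^sub>n|\<^sup>2 r\<^sup>2\<^sup>n\<close>, which the circle means dominate. The bounds may vary with the radius: the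
  isometry proof needs the room for an error term tending to \<open>0\<close>.\<close>

lemma hardy2_of_circle_means:
  assumes f: "f holomorphic_on ball 0 1" and out: "\<And>z. z \<notin> ball 0 1 \<Longrightarrow> f z = 0"
    and r: "\<And>k. 0 \<le> r k" "\<And>k. r k < 1" "r \<longlonglongrightarrow> 1"
    and b: "\<And>k. circle_mean f (r k) \<le> b k" "b \<longlonglongrightarrow> B\<^sup>2" and B: "0 \<le> B"
  shows "f \<in> hardy2" "hardy_norm f \<le> B"
proof -
  have *: "(\<Sum>n<N. (cmod (taylor_coeff f n))\<^sup>2) \<le> B\<^sup>2" for N
  proof (rule LIMSEQ_le)
    show "(\<lambda>k. \<Sum>n<N. (cmod (taylor_coeff f n))\<^sup>2 * r k ^ (2 * n)) \<longlonglongrightarrow> (\<Sum>n<N. (cmod (taylor_coeff f n))\<^sup>2)"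
      by (rule tendsto_eq_intros r refl)+ simp
    show "b \<longlonglongrightarrow> B\<^sup>2" by (rule b)
    have "(\<Sum>n<N. (cmod (taylor_coeff f n))\<^sup>2 * r k ^ (2 * n)) \<le> b k" for k
    proof -
      have "(\<Sum>n<N. (cmod (taylor_coeff f n))\<^sup>2 * r k ^ (2 * n)) \<le> circle_mean f (r k)"
        using circle_mean_Parseval [OF f r(1,2), of k] r(1) [of k]
        by (auto simp: sums_iff intro: sum_le_suminf [THEN order_trans])
      then show ?thesis using b(1) order_trans by blast
    qed
    then show "\<exists>K. \<forall>k\<ge>K. (\<Sum>n<N. (cmod (taylor_coeff f n))\<^sup>2 * r k ^ (2 * n)) \<le> b k" by blast
  qed
  have "summable (\<lambda>n. (cmod (taylor_coeff f n))\<^sup>2)"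
    by (rule summableI_nonneg_bounded [OF _ *]) simp
  then show "f \<in> hardy2"
    using f out by (simp add: hardy2_def)
  then show "hardy_norm f \<le> B"
    using * B by (intro hardy_norm_leI)
qed

definition radius_seq :: "nat \<Rightarrow> real" where
  "radius_seq k = 1 - 1 / real (k + 2)"

lemma radius_seq: "0 \<le> radius_seq k" "radius_seq k < 1" "radius_seq \<longlonglongrightarrow> 1"
proof -
  show "0 \<le> radius_seq k" "radius_seq k < 1" by (auto simp: radius_seq_def)
  have "(\<lambda>k. 1 - 1 / real (k + 2)) \<longlonglongrightarrow> 1 - 0"
    by (intro tendsto_intros LIMSEQ_ignore_initial_segment [of "\<lambda>k. 1 / real k"] lim_1_over_n)
  then show "radius_seq \<longlonglongrightarrow> 1" by (simp add: radius_seq_def [abs_def])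
qed

section \<open>Analytic Toeplitz operators\<close>

lemma toeplitz_holomorphic:
  "\<lbrakk>bounded_analytic \<phi>; f \<in> hardy2\<rbrakk> \<Longrightarrow> toeplitz \<phi> f holomorphic_on ball 0 1"
  unfolding toeplitz_def bounded_analytic_def
  by (rule holomorphic_on_mult) (simp_all add: hardy2_holomorphic)

lemma
  assumes \<phi>: "bounded_analytic \<phi>" and M: "\<And>z. z \<in> ball 0 1 \<Longrightarrow> cmod (\<phi> z) \<le> M"
    and f: "f \<in> hardy2"
  shows toeplitz_hardy2_bound: "toeplitz \<phi> f \<in> hardy2"
    and hardy_norm_toeplitz_le: "hardy_norm (toeplitz \<phi> f) \<le> M * hardy_norm f"
proof -
  have M0: "0 \<le> M" using order_trans [OF norm_ge_zero M [of 0]] by simp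
  have means: "circle_mean (toeplitz \<phi> f) (radius_seq k) \<le> (M * hardy_norm f)\<^sup>2" for k
  proof -
    let ?z = "\<lambda>t. of_real (radius_seq k) * cis t"
    have z: "?z t \<in> ball 0 1" for t by (intro circle_in_disc radius_seq)
    have "(LINT t|lebesgue_on {0..2 * pi}. (cmod (toeplitz \<phi> f (?z t)))\<^sup>2)
        \<le> (LINT t|lebesgue_on {0..2 * pi}. M\<^sup>2 * (cmod (f (?z t)))\<^sup>2)"
    proof (rule integral_mono)
      show "(cmod (toeplitz \<phi> f (?z t)))\<^sup>2 \<le> M\<^sup>2 * (cmod (f (?z t)))\<^sup>2" for t
        unfolding toeplitz_def norm_mult power_mult_distrib
        by (intro mult_right_mono power_mono M z) auto
    qed (intro integrable_mult_right integrable_on_circle toeplitz_holomorphic hardy2_holomorphic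
        \<phi> f radius_seq)+
    then have "circle_mean (toeplitz \<phi> f) (radius_seq k) \<le> M\<^sup>2 * circle_mean f (radius_seq k)"
      by (simp add: circle_mean_def divide_right_mono)
    also have "\<dots> \<le> M\<^sup>2 * (hardy_norm f)\<^sup>2"
      by (intro mult_left_mono circle_mean_le_hardy_norm f radius_seq) auto
    finally show ?thesis by (simp add: power_mult_distrib)
  qed
  have out: "z \<notin> ball 0 1 \<Longrightarrow> toeplitz \<phi> f z = 0" for z
    using f by (simp add: toeplitz_def hardy2_outside)
  have B: "0 \<le> M * hardy_norm f"
    using M0 f by (simp add: hardy_norm_nonneg)
  show "toeplitz \<phi> f \<in> hardy2" "hardy_norm (toeplitz \<phi> f) \<le> M * hardy_norm f"
    by (rule hardy2_of_circle_means
          [OF toeplitz_holomorphic [OF \<phi> f] out radius_seq means tendsto_const B], assumption)+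
qed

lemma bounded_analyticE:
  assumes "bounded_analytic \<phi>"
  obtains M where "\<And>z. z \<in> ball 0 1 \<Longrightarrow> cmod (\<phi> z) \<le> M"
  using assms unfolding bounded_analytic_def bounded_iff by blast

lemma toeplitz_in_hardy2: "\<lbrakk>bounded_analytic \<phi>; f \<in> hardy2\<rbrakk> \<Longrightarrow> toeplitz \<phi> f \<in> hardy2"
  by (metis bounded_analyticE toeplitz_hardy2_bound)

lemma bounded_hardy_op_toeplitz:
  assumes "bounded_analytic \<phi>"
  shows "bounded_hardy_op (toeplitz \<phi>)"
proof -
  obtain M where "\<And>z. z \<in> ball 0 1 \<Longrightarrow> cmod (\<phi> z) \<le> M"
    using bounded_analyticE [OF assms] by blast
  then have "\<exists>K. \<forall>f\<in>hardy2. hardy_norm (toeplitz \<phi> f) \<le> K * hardy_norm f"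
    using hardy_norm_toeplitz_le [OF assms] by blast
  moreover have "toeplitz \<phi> (\<lambda>z. f z + g z) = (\<lambda>z. toeplitz \<phi> f z + toeplitz \<phi> g z)"
    "toeplitz \<phi> (\<lambda>z. c * f z) = (\<lambda>z. c * toeplitz \<phi> f z)" for f g c
    by (simp_all add: toeplitz_def fun_eq_iff algebra_simps)
  ultimately show ?thesis
    unfolding bounded_hardy_op_def using toeplitz_in_hardy2 [OF assms] by blast
qed

lemma bounded_analytic_const: "bounded_analytic (\<lambda>z. c)"
  by (auto simp: bounded_analytic_def bounded_iff)

lemma bounded_analytic_diff:
  "\<lbrakk>bounded_analytic \<phi>; bounded_analytic \<psi>\<rbrakk> \<Longrightarrow> bounded_analytic (\<lambda>z. \<phi> z - \<psi> z)"
  unfolding bounded_analytic_def by (auto intro!: holomorphic_intros bounded_minus_comp)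

lemma bounded_analytic_mult:
  assumes "bounded_analytic \<phi>" "bounded_analytic \<psi>"
  shows "bounded_analytic (\<lambda>z. \<phi> z * \<psi> z)"
proof -
  obtain K where K: "\<And>z. z \<in> ball 0 1 \<Longrightarrow> cmod (\<phi> z) \<le> K"
    using bounded_analyticE [OF assms(1)] by blast
  obtain L where L: "\<And>z. z \<in> ball 0 1 \<Longrightarrow> cmod (\<psi> z) \<le> L"
    using bounded_analyticE [OF assms(2)] by blast
  have "cmod (\<phi> z * \<psi> z) \<le> K * L" if "z \<in> ball 0 1" for z
    unfolding norm_mult using K [OF that] L [OF that] order_trans [OF norm_ge_zero K [OF that]]
    by (intro mult_mono) simp_all
  then have "bounded ((\<lambda>z. \<phi> z * \<psi> z) ` ball 0 1)"
    unfolding bounded_iff by blast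
  then show ?thesis
    using assms by (simp add: bounded_analytic_def holomorphic_on_mult)
qed

lemma bounded_analytic_power: "bounded_analytic \<phi> \<Longrightarrow> bounded_analytic (\<lambda>z. \<phi> z ^ n)"
  by (induction n) (simp_all add: bounded_analytic_const bounded_analytic_mult)

section \<open>Inner functions multiply isometrically\<close>

lemma disc_polynomial_bounded:
  "cmod (disc_polynomial a N z) \<le> (\<Sum>n<N. cmod (a n))"
proof -
  have "cmod (disc_monomial n z) \<le> 1" for n
    by (simp add: disc_monomial_def norm_power power_le_one)
  then show ?thesis
    unfolding disc_polynomial_def
    by (intro sum_norm_le) (simp add: norm_mult mult_left_le)
qed

text \<open>For a polynomial \<open>p\<close> the difference \<open>(|u|\<^sup>2 - 1) |p|\<^sup>2\<close> of the integrands is bounded on the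
  disc and tends to \<open>0\<close> along almost every radius. Hence the circle means of \<open>u p\<close> and \<open>p\<close> become
  equal in the limit, and each norm bounds the other. Polynomials are used because a general
  element of \<open>H\<^sup>2\<close> need not be bounded, so that it would not supply a dominating function.\<close>

lemma inner_function_isometry_polynomial:
  assumes u: "inner_function u"
  shows "hardy_norm (toeplitz u (disc_polynomial a N)) = hardy_norm (disc_polynomial a N)"
proof -
  let ?p = "disc_polynomial a N" and ?q = "toeplitz u (disc_polynomial a N)"
  let ?M = "lebesgue_on {0..2 * pi}"
  let ?z = "\<lambda>k t. of_real (radius_seq k) * cis t"
  have ba: "bounded_analytic u" using u by (simp add: inner_function_def)
  then obtain K where K: "\<And>z. z \<in> ball 0 1 \<Longrightarrow> cmod (u z) \<le> K"
    using bounded_analyticE by blast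
  define P where "P = (\<Sum>n<N. cmod (a n))"
  have P: "cmod (?p z) \<le> P" for z by (simp add: P_def disc_polynomial_bounded)
  have p2: "?p \<in> hardy2" and q2: "?q \<in> hardy2"
    by (auto intro: disc_polynomial_in_hardy2 toeplitz_in_hardy2 ba)
  have ip: "integrable ?M (\<lambda>t. (cmod (?p (?z k t)))\<^sup>2)"
    and iq: "integrable ?M (\<lambda>t. (cmod (?q (?z k t)))\<^sup>2)" for k
    by (intro integrable_on_circle hardy2_holomorphic p2 q2 radius_seq)+
  define \<delta> where "\<delta> k = circle_mean ?q (radius_seq k) - circle_mean ?p (radius_seq k)" for k
  have "(\<lambda>k. integral\<^sup>L ?M (\<lambda>t. (cmod (?q (?z k t)))\<^sup>2 - (cmod (?p (?z k t)))\<^sup>2))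
      \<longlonglongrightarrow> integral\<^sup>L ?M (\<lambda>t. 0)"
  proof (rule integral_dominated_convergence [where w = "\<lambda>t. (K\<^sup>2 + 1) * P\<^sup>2"])
    show "(\<lambda>t. (cmod (?q (?z k t)))\<^sup>2 - (cmod (?p (?z k t)))\<^sup>2) \<in> borel_measurable ?M" for k
      by (intro borel_measurable_integrable Bochner_Integration.integrable_diff ip iq)
    show "integrable ?M (\<lambda>t. (K\<^sup>2 + 1) * P\<^sup>2)"
      by (intro continuous_imp_integrable_real continuous_intros)
    show "AE t in ?M. norm ((cmod (?q (?z k t)))\<^sup>2 - (cmod (?p (?z k t)))\<^sup>2) \<le> (K\<^sup>2 + 1) * P\<^sup>2" for k
    proof (intro AE_I2)
      fix t
      have z: "?z k t \<in> ball 0 1" by (intro circle_in_disc radius_seq)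
      have "(cmod (?q (?z k t)))\<^sup>2 \<le> K\<^sup>2 * P\<^sup>2"
        unfolding toeplitz_def norm_mult power_mult_distrib
        using K [OF z] P by (intro mult_mono power_mono) auto
      moreover have "(cmod (?p (?z k t)))\<^sup>2 \<le> P\<^sup>2"
        using P by (intro power_mono) auto
      ultimately have "(cmod (?q (?z k t)))\<^sup>2 + (cmod (?p (?z k t)))\<^sup>2 \<le> (K\<^sup>2 + 1) * P\<^sup>2"
        by (simp add: algebra_simps)
      then show "norm ((cmod (?q (?z k t)))\<^sup>2 - (cmod (?p (?z k t)))\<^sup>2) \<le> (K\<^sup>2 + 1) * P\<^sup>2"
        using zero_le_power2 [of "cmod (?q (?z k t))"] zero_le_power2 [of "cmod (?p (?z k t))"]
        unfolding real_norm_def abs_le_iff by linarith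
    qed
    have "AE t in ?M. \<exists>w. cmod w = 1 \<and> ((\<lambda>r. u (of_real r * cis t)) \<longlongrightarrow> w) (at_left 1)"
      using u by (simp add: inner_function_def)
    then show "AE t in ?M. (\<lambda>k. (cmod (?q (?z k t)))\<^sup>2 - (cmod (?p (?z k t)))\<^sup>2) \<longlonglongrightarrow> 0"
    proof eventually_elim
      fix t
      assume "\<exists>w. cmod w = 1 \<and> ((\<lambda>r. u (of_real r * cis t)) \<longlongrightarrow> w) (at_left 1)"
      then obtain w where w: "cmod w = 1" "((\<lambda>r. u (of_real r * cis t)) \<longlongrightarrow> w) (at_left 1)" by blast
      have "filterlim radius_seq (at_left 1) sequentially"
        unfolding filterlim_at
        by (intro conjI always_eventually allI) (simp_all add: radius_seq less_imp_neq)
      from filterlim_compose [OF w(2) this] have "(\<lambda>k. u (?z k t)) \<longlonglongrightarrow> w" by simp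
      then have "(\<lambda>k. (cmod (u (?z k t)))\<^sup>2 - 1) \<longlonglongrightarrow> (cmod w)\<^sup>2 - 1"
        by (intro tendsto_intros)
      then have "(\<lambda>k. P\<^sup>2 * norm ((cmod (u (?z k t)))\<^sup>2 - 1)) \<longlonglongrightarrow> 0"
        using w(1) by (intro tendsto_mult_right_zero tendsto_norm_zero) simp
      then show "(\<lambda>k. (cmod (?q (?z k t)))\<^sup>2 - (cmod (?p (?z k t)))\<^sup>2) \<longlonglongrightarrow> 0"
      proof (rule Lim_null_comparison [rotated], intro always_eventually allI)
        fix k
        have eq: "(cmod (?q (?z k t)))\<^sup>2 - (cmod (?p (?z k t)))\<^sup>2
            = (cmod (?p (?z k t)))\<^sup>2 * ((cmod (u (?z k t)))\<^sup>2 - 1)"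
          by (simp add: toeplitz_def norm_mult power_mult_distrib algebra_simps)
        show "norm ((cmod (?q (?z k t)))\<^sup>2 - (cmod (?p (?z k t)))\<^sup>2)
            \<le> P\<^sup>2 * norm ((cmod (u (?z k t)))\<^sup>2 - 1)"
          unfolding eq norm_mult using P by (intro mult_right_mono) (auto intro!: power_mono)
      qed
    qed
  qed simp
  then have "(\<lambda>k. integral\<^sup>L ?M (\<lambda>t. (cmod (?q (?z k t)))\<^sup>2 - (cmod (?p (?z k t)))\<^sup>2) / (2 * pi))
      \<longlonglongrightarrow> 0 / (2 * pi)"
    by (intro tendsto_divide) auto
  then have \<delta>: "\<delta> \<longlonglongrightarrow> 0"
    by (simp add: \<delta>_def [abs_def] circle_mean_def ip iq diff_divide_distrib)
  have "hardy_norm ?q \<le> hardy_norm ?p"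
  proof (rule hardy2_of_circle_means(2) [OF hardy2_holomorphic [OF q2] _ radius_seq])
    show "circle_mean ?q (radius_seq k) \<le> (hardy_norm ?p)\<^sup>2 + \<delta> k" for k
      using circle_mean_le_hardy_norm [OF p2 radius_seq(1,2), of k] by (simp add: \<delta>_def)
    show "(\<lambda>k. (hardy_norm ?p)\<^sup>2 + \<delta> k) \<longlonglongrightarrow> (hardy_norm ?p)\<^sup>2"
      using tendsto_add [OF tendsto_const \<delta>] by simp
  qed (use p2 q2 in \<open>auto simp: hardy2_outside hardy_norm_nonneg\<close>)
  moreover have "hardy_norm ?p \<le> hardy_norm ?q"
  proof (rule hardy2_of_circle_means(2) [OF hardy2_holomorphic [OF p2] _ radius_seq])
    show "circle_mean ?p (radius_seq k) \<le> (hardy_norm ?q)\<^sup>2 - \<delta> k" for k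
      using circle_mean_le_hardy_norm [OF q2 radius_seq(1,2), of k] by (simp add: \<delta>_def)
    show "(\<lambda>k. (hardy_norm ?q)\<^sup>2 - \<delta> k) \<longlonglongrightarrow> (hardy_norm ?q)\<^sup>2"
      using tendsto_diff [OF tendsto_const \<delta>] by simp
  qed (use p2 q2 in \<open>auto simp: hardy2_outside hardy_norm_nonneg\<close>)
  ultimately show ?thesis by simp
qed


lemma hardy_norm_le_add_diff:
  assumes "f \<in> hardy2" "g \<in> hardy2"
  shows "hardy_norm f \<le> hardy_norm g + hardy_norm (\<lambda>z. f z - g z)"
    and "hardy_norm g \<le> hardy_norm f + hardy_norm (\<lambda>z. f z - g z)"
proof -
  have d: "(\<lambda>z. f z - g z) \<in> hardy2" by (intro hardy2_diff assms)
  show "hardy_norm f \<le> hardy_norm g + hardy_norm (\<lambda>z. f z - g z)"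
    using hardy_norm_triangle [OF assms(2) d] by simp
  show "hardy_norm g \<le> hardy_norm f + hardy_norm (\<lambda>z. f z - g z)"
    using hardy_norm_triangle [OF assms(1) hardy2_cmult [OF d, of "-1"]] hardy_norm_cmult [OF d, of "-1"]
    by simp
qed

text \<open>Polynomials are dense and multiplication by \<open>u\<close> is bounded, so the identity of norms extends
  from polynomials to \<open>H\<^sup>2\<close>.\<close>

lemma inner_function_isometry:
  assumes u: "inner_function u" and f: "f \<in> hardy2"
  shows "hardy_norm (toeplitz u f) = hardy_norm f"
proof -
  have ba: "bounded_analytic u" using u by (simp add: inner_function_def)
  then obtain M where M: "\<And>z. z \<in> ball 0 1 \<Longrightarrow> cmod (u z) \<le> M"
    using bounded_analyticE by blast
  let ?p = "disc_polynomial (taylor_coeff f)"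
  let ?e = "\<lambda>N. hardy_norm (\<lambda>z. f z - ?p N z)"
  have "\<bar>hardy_norm (toeplitz u f) - hardy_norm f\<bar> \<le> (M + 1) * ?e N" for N
  proof -
    have p: "?p N \<in> hardy2" by (rule disc_polynomial_in_hardy2)
    have "(\<lambda>z. toeplitz u f z - toeplitz u (?p N) z) = toeplitz u (\<lambda>z. f z - ?p N z)"
      by (simp add: toeplitz_def fun_eq_iff algebra_simps)
    then have "hardy_norm (\<lambda>z. toeplitz u f z - toeplitz u (?p N) z) \<le> M * ?e N"
      using hardy_norm_toeplitz_le [OF ba M hardy2_diff [OF f p]] by simp
    then show ?thesis
      using hardy_norm_le_add_diff [OF f p]
        hardy_norm_le_add_diff [OF toeplitz_in_hardy2 [OF ba f] toeplitz_in_hardy2 [OF ba p]]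
      unfolding inner_function_isometry_polynomial [OF u] abs_le_iff distrib_right mult_1 by linarith
  qed
  moreover have "(\<lambda>N. (M + 1) * ?e N) \<longlonglongrightarrow> 0"
    by (intro tendsto_mult_right_zero disc_polynomial_approximates f)
  ultimately have "\<bar>hardy_norm (toeplitz u f) - hardy_norm f\<bar> \<le> 0"
    by (intro LIMSEQ_le_const) auto
  then show ?thesis by simp
qed

lemma hardy_norm_add_power2:
  assumes f: "f \<in> hardy2" and g: "g \<in> hardy2"
  shows "(hardy_norm (\<lambda>z. f z + g z))\<^sup>2
    = (hardy_norm f)\<^sup>2 + (hardy_norm g)\<^sup>2 + 2 * Re (hardy_inner f g)"
proof -
  let ?s = "\<lambda>z. f z + g z"
  have s: "?s \<in> hardy2" by (intro hardy2_add f g)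
  have "hardy_inner ?s ?s = hardy_inner f ?s + hardy_inner g ?s"
    by (intro hardy_inner_add_left f g s)
  also have "\<dots> = cnj (hardy_inner ?s f) + cnj (hardy_inner ?s g)"
    using hardy_inner_commute [OF s f] hardy_inner_commute [OF s g] by simp
  also have "\<dots> = cnj (hardy_inner f f + hardy_inner g f) + cnj (hardy_inner f g + hardy_inner g g)"
    by (simp add: hardy_inner_add_left f g)
  finally show ?thesis
    unfolding hardy_inner_self [OF s] hardy_inner_self [OF f] hardy_inner_self [OF g]
      hardy_inner_commute [OF f g]
    by (simp add: complex_eq_iff)
qed

text \<open>Polarisation: preserving norms of sums preserves real parts of inner products, and the imaginary
  part of \<open>\<langle>f, g\<rangle>\<close> is minus the real part of \<open>\<langle>\<i> f, g\<rangle>\<close>.\<close>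

lemma inner_function_preserves_inner:
  assumes u: "inner_function u" and f: "f \<in> hardy2" and g: "g \<in> hardy2"
  shows "hardy_inner (toeplitz u f) (toeplitz u g) = hardy_inner f g"
proof -
  have ba: "bounded_analytic u" using u by (simp add: inner_function_def)
  have Re: "Re (hardy_inner (toeplitz u h) (toeplitz u g)) = Re (hardy_inner h g)" if h: "h \<in> hardy2" for h
  proof -
    have "toeplitz u (\<lambda>z. h z + g z) = (\<lambda>z. toeplitz u h z + toeplitz u g z)"
      by (simp add: toeplitz_def fun_eq_iff algebra_simps)
    then have "hardy_norm (\<lambda>z. toeplitz u h z + toeplitz u g z) = hardy_norm (\<lambda>z. h z + g z)"
      using inner_function_isometry [OF u hardy2_add [OF h g]] by simp
    then show ?thesis
      using hardy_norm_add_power2 [OF h g]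
        hardy_norm_add_power2 [OF toeplitz_in_hardy2 [OF ba h] toeplitz_in_hardy2 [OF ba g]]
      by (simp add: inner_function_isometry [OF u] h g)
  qed
  have "toeplitz u (\<lambda>z. \<i> * f z) = (\<lambda>z. \<i> * toeplitz u f z)"
    by (simp add: toeplitz_def fun_eq_iff algebra_simps)
  then have "Im (hardy_inner (toeplitz u f) (toeplitz u g)) = Im (hardy_inner f g)"
    using Re [OF hardy2_cmult [OF f, of \<i>]]
    by (simp add: hardy_inner_cmult_left toeplitz_in_hardy2 ba f g)
  then show ?thesis using Re [OF f] by (simp add: complex_eq_iff)
qed

lemma inner_function_power:
  assumes "inner_function u"
  shows "inner_function (\<lambda>z. u z ^ n)"
proof -
  have "AE t in lebesgue_on {0..2 * pi}.
      \<exists>w. cmod w = 1 \<and> ((\<lambda>r. u (of_real r * cis t)) \<longlongrightarrow> w) (at_left 1)"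
    using assms by (simp add: inner_function_def)
  then have "AE t in lebesgue_on {0..2 * pi}.
      \<exists>w. cmod w = 1 \<and> ((\<lambda>r. u (of_real r * cis t) ^ n) \<longlongrightarrow> w) (at_left 1)"
  proof eventually_elim
    fix t
    assume "\<exists>w. cmod w = 1 \<and> ((\<lambda>r. u (of_real r * cis t)) \<longlongrightarrow> w) (at_left 1)"
    then obtain w where "cmod w = 1" "((\<lambda>r. u (of_real r * cis t)) \<longlongrightarrow> w) (at_left 1)" by blast
    then have "cmod (w ^ n) = 1" "((\<lambda>r. u (of_real r * cis t) ^ n) \<longlongrightarrow> w ^ n) (at_left 1)"
      by (simp_all add: norm_power tendsto_power)
    then show "\<exists>w. cmod w = 1 \<and> ((\<lambda>r. u (of_real r * cis t) ^ n) \<longlongrightarrow> w) (at_left 1)" by blast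
  qed
  then show ?thesis
    using assms by (simp add: inner_function_def bounded_analytic_power)
qed

text \<open>The powers \<open>u\<^sup>n\<close> all have the same norm as the constant \<open>1\<close>, so their values at \<open>z\<close> stay bounded as
  \<open>n\<close> grows.\<close>

lemma inner_function_le_1:
  assumes u: "inner_function u" and z: "z \<in> ball 0 1"
  shows "cmod (u z) \<le> 1"
proof (rule ccontr)
  assume "\<not> cmod (u z) \<le> 1"
  let ?one = "disc_monomial 0"
  obtain C where C: "\<And>f. f \<in> hardy2 \<Longrightarrow> cmod (f z) \<le> C * hardy_norm f"
    using hardy2_point_evaluation_bounded [OF z] by blast
  obtain n where n: "C * hardy_norm ?one < cmod (u z) ^ n"
    using real_arch_pow \<open>\<not> cmod (u z) \<le> 1\<close> by (meson not_le)
  have un: "inner_function (\<lambda>z. u z ^ n)" by (rule inner_function_power [OF u])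
  then have "toeplitz (\<lambda>z. u z ^ n) ?one \<in> hardy2"
    by (intro toeplitz_in_hardy2 disc_monomial_in_hardy2) (simp add: inner_function_def)
  then have "cmod (toeplitz (\<lambda>z. u z ^ n) ?one z) \<le> C * hardy_norm ?one"
    using C inner_function_isometry [OF un disc_monomial_in_hardy2] by metis
  then show False
    using n z by (simp add: toeplitz_def disc_monomial_def norm_mult norm_power)
qed

lemma inner_function_less_1:
  assumes u: "inner_function u" and nc: "\<not> u constant_on ball 0 1" and z: "z \<in> ball 0 1"
  shows "cmod (u z) < 1"
proof (rule ccontr)
  assume "\<not> cmod (u z) < 1"
  then have "cmod (u y) \<le> cmod (u z)" if "y \<in> ball 0 1" for y
    using inner_function_le_1 [OF u that] by simp
  moreover have "u holomorphic_on ball 0 1"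
    using u by (simp add: inner_function_def bounded_analytic_def)
  ultimately have "u constant_on ball 0 1"
    using z by (intro maximum_modulus_principle [of u "ball 0 1" "ball 0 1" z]) auto
  with nc show False by simp
qed

section \<open>Frostman shifts\<close>

text \<open>For \<open>\<mu>\<close> in the disc this is the disc automorphism sending \<open>\<mu>\<close> to \<open>0\<close>; composed with an inner
  function it gives another one.\<close>

definition frostman_shift :: "complex \<Rightarrow> complex \<Rightarrow> complex" where
  "frostman_shift \<mu> w = (w - \<mu>) / (1 - cnj \<mu> * w)"

lemma frostman_denominator_nonzero:
  assumes "cmod \<mu> < 1" "cmod w \<le> 1"
  shows "1 - cnj \<mu> * w \<noteq> 0"
proof
  assume "1 - cnj \<mu> * w = 0"
  then have "cmod \<mu> * cmod w = 1"
    by (metis complex_mod_cnj eq_iff_diff_eq_0 norm_mult norm_one)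
  moreover have "cmod \<mu> * cmod w \<le> cmod \<mu> * 1"
    using assms by (intro mult_left_mono) auto
  ultimately show False using assms(1) by simp
qed

text \<open>Both the strict contraction inside the disc and the preservation of the unit circle are read off
  from the sign of the right-hand side.\<close>

lemma frostman_identity:
  "(cmod (1 - cnj \<mu> * w))\<^sup>2 - (cmod (w - \<mu>))\<^sup>2 = (1 - (cmod \<mu>)\<^sup>2) * (1 - (cmod w)\<^sup>2)"
  unfolding cmod_power2 by (simp add: power2_eq_square algebra_simps)

lemma
  assumes \<mu>: "cmod \<mu> < 1"
  shows frostman_shift_less_1: "cmod w < 1 \<Longrightarrow> cmod (frostman_shift \<mu> w) < 1"
    and frostman_shift_eq_1: "cmod w = 1 \<Longrightarrow> cmod (frostman_shift \<mu> w) = 1"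
proof -
  assume w: "cmod w < 1"
  have "(1 - (cmod \<mu>)\<^sup>2) * (1 - (cmod w)\<^sup>2) > 0"
    using \<mu> w by (intro mult_pos_pos) (auto simp: power_less_one_iff)
  then have "(cmod (w - \<mu>))\<^sup>2 < (cmod (1 - cnj \<mu> * w))\<^sup>2"
    using frostman_identity [of \<mu> w] by linarith
  then have "cmod (w - \<mu>) < cmod (1 - cnj \<mu> * w)"
    by (rule power2_less_imp_less) simp
  then show "cmod (frostman_shift \<mu> w) < 1"
    using frostman_denominator_nonzero [OF \<mu>, of w] w
    by (simp add: frostman_shift_def norm_divide)
next
  assume w: "cmod w = 1"
  then have "(cmod (w - \<mu>))\<^sup>2 = (cmod (1 - cnj \<mu> * w))\<^sup>2"
    using frostman_identity [of \<mu> w] by simp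
  then have "cmod (w - \<mu>) = cmod (1 - cnj \<mu> * w)"
    by (rule power2_eq_imp_eq) auto
  then show "cmod (frostman_shift \<mu> w) = 1"
    using frostman_denominator_nonzero [OF \<mu>, of w] w
    by (simp add: frostman_shift_def norm_divide)
qed

lemma inner_function_frostman_shift:
  assumes u: "inner_function u" and nc: "\<not> u constant_on ball 0 1" and \<mu>: "cmod \<mu> < 1"
  shows "inner_function (\<lambda>z. frostman_shift \<mu> (u z))"
proof -
  have "u holomorphic_on ball 0 1"
    using u by (simp add: inner_function_def bounded_analytic_def)
  then have "(\<lambda>z. frostman_shift \<mu> (u z)) holomorphic_on ball 0 1"
    unfolding frostman_shift_def
    by (intro holomorphic_intros frostman_denominator_nonzero \<mu> inner_function_le_1 [OF u])
  moreover have "bounded ((\<lambda>z. frostman_shift \<mu> (u z)) ` ball 0 1)"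
    unfolding bounded_iff
    using frostman_shift_less_1 [OF \<mu> inner_function_less_1 [OF u nc]] less_imp_le by blast
  moreover have "AE t in lebesgue_on {0..2 * pi}.
      \<exists>w. cmod w = 1 \<and> ((\<lambda>r. u (of_real r * cis t)) \<longlongrightarrow> w) (at_left 1)"
    using u by (simp add: inner_function_def)
  then have "AE t in lebesgue_on {0..2 * pi}.
      \<exists>w. cmod w = 1 \<and> ((\<lambda>r. frostman_shift \<mu> (u (of_real r * cis t))) \<longlongrightarrow> w) (at_left 1)"
  proof eventually_elim
    fix t
    assume "\<exists>w. cmod w = 1 \<and> ((\<lambda>r. u (of_real r * cis t)) \<longlongrightarrow> w) (at_left 1)"
    then obtain w where w: "cmod w = 1" "((\<lambda>r. u (of_real r * cis t)) \<longlongrightarrow> w) (at_left 1)" by blast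
    have "((\<lambda>r. frostman_shift \<mu> (u (of_real r * cis t))) \<longlongrightarrow> frostman_shift \<mu> w) (at_left 1)"
      unfolding frostman_shift_def
      using w by (intro tendsto_intros frostman_denominator_nonzero \<mu>) auto
    then show "\<exists>w. cmod w = 1 \<and> ((\<lambda>r. frostman_shift \<mu> (u (of_real r * cis t))) \<longlongrightarrow> w) (at_left 1)"
      using frostman_shift_eq_1 [OF \<mu> w(1)] by blast
  qed
  ultimately show ?thesis
    by (simp add: inner_function_def bounded_analytic_def)
qed

section \<open>Intertwining operators\<close>

text \<open>The operator \<open>S\<close> plays the role of one with dense range. The vector \<open>v = X f - u g\<close>, with \<open>g\<close> the
  adjoint of multiplication by \<open>u\<close> applied to \<open>X f\<close>, is the component of \<open>X f\<close> orthogonal to \<open>u H\<^sup>2\<close>,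
  because multiplication by \<open>u\<close> is isometric. So \<open>X\<^sup>* v\<close> is orthogonal to the range of \<open>S\<close> and
  vanishes, which makes \<open>v\<close> orthogonal to \<open>X f\<close> as well, hence to itself. Working with this explicit
  projection replaces the closedness of \<open>u H\<^sup>2\<close>.\<close>

lemma range_divisible_by_inner:
  assumes X: "bounded_hardy_op X" and u: "inner_function u"
    and dense: "\<And>w. \<lbrakk>w \<in> hardy2; \<And>f. f \<in> hardy2 \<Longrightarrow> hardy_inner (S f) w = 0\<rbrakk> \<Longrightarrow> w = (\<lambda>z. 0)"
    and S: "\<And>f. f \<in> hardy2 \<Longrightarrow> S f \<in> hardy2"
    and XS: "\<And>f. f \<in> hardy2 \<Longrightarrow> \<exists>h\<in>hardy2. X (S f) = toeplitz u h"
    and f: "f \<in> hardy2"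
  obtains g where "g \<in> hardy2" "X f = toeplitz u g"
proof -
  have ba: "bounded_analytic u" using u by (simp add: inner_function_def)
  note T = bounded_hardy_op_toeplitz [OF ba] toeplitz_in_hardy2 [OF ba]
  define g where "g = hardy_adjoint (toeplitz u) (X f)"
  define v where "v z = X f z - toeplitz u g z" for z
  have Xf: "X f \<in> hardy2" using X f by (simp add: bounded_hardy_op_def)
  have g: "g \<in> hardy2" unfolding g_def by (intro hardy_adjoint_in_hardy2 T Xf)
  have v: "v \<in> hardy2" unfolding v_def by (intro hardy2_diff T Xf g)
  have orth: "hardy_inner (toeplitz u h) v = 0" if h: "h \<in> hardy2" for h
  proof -
    have "hardy_inner (toeplitz u h) v
        = hardy_inner (toeplitz u h) (X f) - hardy_inner (toeplitz u h) (toeplitz u g)"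
      unfolding v_def by (intro hardy_inner_diff_right T Xf g h)
    also have "\<dots> = hardy_inner h g - hardy_inner h g"
      using hardy_inner_adjoint [OF T(1) Xf h] inner_function_preserves_inner [OF u h g]
      by (simp add: g_def)
    finally show ?thesis by simp
  qed
  have "hardy_adjoint X v = (\<lambda>z. 0)"
  proof (rule dense)
    show "hardy_adjoint X v \<in> hardy2" by (rule hardy_adjoint_in_hardy2 [OF X v])
    fix k assume k: "k \<in> hardy2"
    then obtain h where "h \<in> hardy2" "X (S k) = toeplitz u h" using XS by blast
    then show "hardy_inner (S k) (hardy_adjoint X v) = 0"
      using hardy_inner_adjoint [OF X v S [OF k]] orth by simp
  qed
  then have "hardy_inner (X f) v = 0"
    using hardy_inner_adjoint [OF X v f] by (simp add: hardy_inner_def taylor_coeff_zero)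
  then have "hardy_inner v v = 0"
    using hardy_inner_diff_left [OF Xf T(2) [OF g] v] orth [OF g] by (simp add: v_def [abs_def])
  then have "v = (\<lambda>z. 0)" by (rule hardy_inner_self_eq_0 [OF v])
  then have "X f = toeplitz u g" by (simp add: v_def fun_eq_iff)
  with g that show ?thesis by blast
qed

text \<open>Orthogonality to the range of \<open>(T\<^sub>\<phi> - \<mu>)\<^sup>n\<close> means lying in the kernel of \<open>(T\<^sub>\<phi>\<^sup>* - cnj \<mu>)\<^sup>n\<close>, which is
  trivial together with the kernel of \<open>T\<^sub>\<phi>\<^sup>* - cnj \<mu>\<close>. The induction peels off one factor at a time.\<close>

lemma orthogonal_to_range_power_trivial:
  assumes \<phi>: "bounded_analytic \<phi>"
    and no_eigenvalue: "cnj \<mu> \<notin> point_spectrum (hardy_adjoint (toeplitz \<phi>))"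
    and w: "w \<in> hardy2"
    and orth: "\<And>f. f \<in> hardy2 \<Longrightarrow> hardy_inner (toeplitz (\<lambda>z. (\<phi> z - \<mu>) ^ n) f) w = 0"
  shows "w = (\<lambda>z. 0)"
  using w orth
proof (induction n arbitrary: w)
  case 0
  have "hardy_inner w w = 0" using 0(2) [OF 0(1)] by (simp add: toeplitz_def)
  then show ?case by (rule hardy_inner_self_eq_0 [OF 0(1)])
next
  case (Suc n)
  note T = bounded_hardy_op_toeplitz [OF \<phi>]
  let ?A = "hardy_adjoint (toeplitz \<phi>) w"
  have A: "?A \<in> hardy2" by (rule hardy_adjoint_in_hardy2 [OF T Suc.prems(1)])
  note cw = hardy2_cmult [OF Suc.prems(1)]
  have "(\<lambda>z. ?A z - cnj \<mu> * w z) = (\<lambda>z. 0)"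
  proof (rule Suc.IH)
    show "(\<lambda>z. ?A z - cnj \<mu> * w z) \<in> hardy2" by (intro hardy2_diff A cw)
    fix f assume f: "f \<in> hardy2"
    let ?g = "toeplitz (\<lambda>z. (\<phi> z - \<mu>) ^ n) f"
    have g: "?g \<in> hardy2"
      by (intro toeplitz_in_hardy2 bounded_analytic_power bounded_analytic_diff
          bounded_analytic_const \<phi> f)
    have "hardy_inner ?g (\<lambda>z. ?A z - cnj \<mu> * w z) = hardy_inner ?g ?A - \<mu> * hardy_inner ?g w"
      by (simp add: hardy_inner_diff_right hardy_inner_cmult_right A cw g Suc.prems(1))
    also have "\<dots> = hardy_inner (toeplitz \<phi> ?g) w - hardy_inner (\<lambda>z. \<mu> * ?g z) w"
      by (simp add: hardy_inner_adjoint [OF T Suc.prems(1) g] hardy_inner_cmult_left g Suc.prems(1))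
    also have "\<dots> = hardy_inner (\<lambda>z. toeplitz \<phi> ?g z - \<mu> * ?g z) w"
      by (simp add: hardy_inner_diff_left toeplitz_in_hardy2 \<phi> g hardy2_cmult Suc.prems(1))
    also have "(\<lambda>z. toeplitz \<phi> ?g z - \<mu> * ?g z) = toeplitz (\<lambda>z. (\<phi> z - \<mu>) ^ Suc n) f"
      by (simp add: toeplitz_def fun_eq_iff algebra_simps)
    finally show "hardy_inner ?g (\<lambda>z. ?A z - cnj \<mu> * w z) = 0"
      using Suc.prems(2) [OF f] by simp
  qed
  then have "?A = (\<lambda>z. cnj \<mu> * w z)" by (simp add: fun_eq_iff)
  with no_eigenvalue Suc.prems(1) show ?case
    unfolding point_spectrum_def by blast
qed

lemma bounded_hardy_op_add:
  "\<lbrakk>bounded_hardy_op X; f \<in> hardy2; g \<in> hardy2\<rbrakk>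
    \<Longrightarrow> X (\<lambda>z. f z + g z) = (\<lambda>z. X f z + X g z)"
  by (simp add: bounded_hardy_op_def)

lemma bounded_hardy_op_cmult:
  "\<lbrakk>bounded_hardy_op X; f \<in> hardy2\<rbrakk> \<Longrightarrow> X (\<lambda>z. c * f z) = (\<lambda>z. c * X f z)"
  by (simp add: bounded_hardy_op_def)

lemma intertwining_power:
  assumes X: "bounded_hardy_op X" and \<phi>: "bounded_analytic \<phi>"
    and XT: "\<And>f. f \<in> hardy2 \<Longrightarrow> X (toeplitz \<phi> f) = toeplitz \<psi> (X f)" and f: "f \<in> hardy2"
  shows "X (toeplitz (\<lambda>z. (\<phi> z - \<mu>) ^ n) f) = toeplitz (\<lambda>z. (\<psi> z - \<mu>) ^ n) (X f)"
proof (induction n)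
  case 0
  then show ?case by (simp add: toeplitz_def)
next
  case (Suc n)
  let ?g = "toeplitz (\<lambda>z. (\<phi> z - \<mu>) ^ n) f"
  have g: "?g \<in> hardy2"
    by (intro toeplitz_in_hardy2 bounded_analytic_power bounded_analytic_diff
        bounded_analytic_const \<phi> f)
  have "toeplitz (\<lambda>z. (\<phi> z - \<mu>) ^ Suc n) f = (\<lambda>z. toeplitz \<phi> ?g z + (- \<mu>) * ?g z)"
    by (simp add: toeplitz_def fun_eq_iff algebra_simps)
  then have "X (toeplitz (\<lambda>z. (\<phi> z - \<mu>) ^ Suc n) f) = X (\<lambda>z. toeplitz \<phi> ?g z + (- \<mu>) * ?g z)"
    by (rule arg_cong)
  also have "\<dots> = (\<lambda>z. X (toeplitz \<phi> ?g) z + X (\<lambda>z. (- \<mu>) * ?g z) z)"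
    by (intro bounded_hardy_op_add X toeplitz_in_hardy2 \<phi> hardy2_cmult g)
  also have "X (\<lambda>z. (- \<mu>) * ?g z) = (\<lambda>z. (- \<mu>) * X ?g z)"
    by (intro bounded_hardy_op_cmult X g)
  finally show ?case
    unfolding XT [OF g] Suc.IH by (simp add: toeplitz_def fun_eq_iff algebra_simps)
qed

theorem corollary6p3:
  fixes \<phi> \<psi> :: "complex \<Rightarrow> complex"
  assumes "bounded_analytic \<phi>"
    and "bounded_analytic \<psi>"
    and "inner_function \<psi>"
    and "\<not> \<psi> constant_on ball 0 1"
    and "toeplitz \<phi> \<propto> toeplitz \<psi>"
  shows "ball 0 1 \<subseteq> point_spectrum (hardy_adjoint (toeplitz \<phi>))"
proof (rule subsetI, rule ccontr)
  fix c :: complex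
  assume c: "c \<in> ball 0 1" and no_eigenvalue: "c \<notin> point_spectrum (hardy_adjoint (toeplitz \<phi>))"
  define \<mu> where "\<mu> = cnj c"
  have \<mu>: "cmod \<mu> < 1" using c by (simp add: \<mu>_def)
  have no_eigenvalue: "cnj \<mu> \<notin> point_spectrum (hardy_adjoint (toeplitz \<phi>))"
    using no_eigenvalue by (simp add: \<mu>_def)
  obtain X f where X: "bounded_hardy_op X" and f: "f \<in> hardy2" and nonzero: "X f \<noteq> (\<lambda>z. 0)"
    and XT: "\<And>f. f \<in> hardy2 \<Longrightarrow> X (toeplitz \<phi> f) = toeplitz \<psi> (X f)"
    using assms(5) unfolding intertwined_def by blast
  have X2: "k \<in> hardy2 \<Longrightarrow> X k \<in> hardy2" for k
    using X by (simp add: bounded_hardy_op_def)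
  define \<theta> where "\<theta> z = frostman_shift \<mu> (\<psi> z)" for z
  have \<theta>: "inner_function \<theta>"
    unfolding \<theta>_def by (intro inner_function_frostman_shift assms \<mu>)
  have \<theta>_less_1: "cmod (\<theta> z) < 1" if "z \<in> ball 0 1" for z
    unfolding \<theta>_def by (intro frostman_shift_less_1 inner_function_less_1 assms \<mu> that)
  have factor: "\<psi> z - \<mu> = \<theta> z * (1 - cnj \<mu> * \<psi> z)" if "z \<in> ball 0 1" for z
    using frostman_denominator_nonzero [OF \<mu> inner_function_le_1 [OF assms(3) that]]
    by (simp add: \<theta>_def frostman_shift_def)
  have divisible: "\<exists>g\<in>hardy2. X f = toeplitz (\<lambda>z. \<theta> z ^ n) g" for n
  proof (rule range_divisible_by_inner [OF X inner_function_power [OF \<theta>]])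
    let ?S = "toeplitz (\<lambda>z. (\<phi> z - \<mu>) ^ n)"
    show "w = (\<lambda>z. 0)" if "w \<in> hardy2" "\<And>k. k \<in> hardy2 \<Longrightarrow> hardy_inner (?S k) w = 0" for w
      by (rule orthogonal_to_range_power_trivial [OF assms(1) no_eigenvalue that])
    show "?S k \<in> hardy2" if "k \<in> hardy2" for k
      by (intro toeplitz_in_hardy2 bounded_analytic_power bounded_analytic_diff
          bounded_analytic_const assms that)
    show "\<exists>h\<in>hardy2. X (?S k) = toeplitz (\<lambda>z. \<theta> z ^ n) h" if k: "k \<in> hardy2" for k
    proof
      let ?h = "toeplitz (\<lambda>z. (1 - cnj \<mu> * \<psi> z) ^ n) (X k)"
      show "?h \<in> hardy2"
        by (intro toeplitz_in_hardy2 bounded_analytic_power bounded_analytic_diff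
            bounded_analytic_mult bounded_analytic_const assms X2 k)
      have "(\<psi> z - \<mu>) ^ n * X k z = \<theta> z ^ n * ((1 - cnj \<mu> * \<psi> z) ^ n * X k z)" for z
        by (cases "z \<in> ball 0 1") (simp_all add: factor power_mult_distrib hardy2_outside [OF X2 [OF k]]
            del: mem_ball)
      then show "X (?S k) = toeplitz (\<lambda>z. \<theta> z ^ n) ?h"
        by (simp only: intertwining_power [OF X assms(1) XT k]) (simp only: toeplitz_def)
    qed
  qed (use f in blast)+
  have "X f z = 0" if z: "z \<in> ball 0 1" for z
  proof -
    obtain C where C: "\<And>g. g \<in> hardy2 \<Longrightarrow> cmod (g z) \<le> C * hardy_norm g"
      using hardy2_point_evaluation_bounded [OF z] by blast
    have "cmod (X f z) \<le> cmod (\<theta> z) ^ n * (C * hardy_norm (X f))" for n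
    proof -
      obtain g where g: "g \<in> hardy2" and Xf: "X f = toeplitz (\<lambda>z. \<theta> z ^ n) g"
        using divisible by blast
      have "hardy_norm (X f) = hardy_norm g"
        unfolding Xf by (rule inner_function_isometry [OF inner_function_power [OF \<theta>] g])
      then have "cmod (g z) \<le> C * hardy_norm (X f)" using C [OF g] by simp
      then show ?thesis
        by (subst Xf) (simp add: toeplitz_def norm_mult norm_power mult_left_mono)
    qed
    moreover have "(\<lambda>n. cmod (\<theta> z) ^ n * (C * hardy_norm (X f))) \<longlonglongrightarrow> 0"
      using \<theta>_less_1 [OF z] by (intro tendsto_mult_left_zero LIMSEQ_power_zero) simp
    ultimately have "cmod (X f z) \<le> 0"
      by (intro LIMSEQ_le_const) auto
    then show ?thesis by simp
  qed
  then have "X f = (\<lambda>z. 0)"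
    using hardy2_outside [OF X2 [OF f]] by blast
  with nonzero show False by contradiction
qed

end
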